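(* Let $C>0$ be a constant and define the linear program $$P_{\mathrm{distr}}:\quad \min\{\mathbf c^T\mathbf x \mid \mathbf A\mathbf x=\mathbf b,\ \mathbf 0\le \mathbf x\le C\boldsymbol\xi\}.$$ Let $J=\{j_1,\dots,j_K\}$ be drawn i.i.d. from $\boldsymbol\xi$ and let $P_J$ be the column-randomized LP. Let $\chi$ be an upper bound on $\|\bar{\mathbf c}\|_2$ for every basic solution of the complete problem $P$, where $\bar{\mathbf c}$ is the reduced cost vector of the corresponding basis. For any $\delta\in(0,1)$, with probability at least $1-\delta$ over the sample $J$, the following implication holds: if $P_J$ is feasible and $\mathrm{rank}(\mathbf A_J)=m$, then $$\Delta v(P_J)\le \Delta v(P_{\mathrm{distr}})+\frac{C}{\sqrt K}\cdot\chi\cdot\left(1+\sqrt{2\log\frac{1}{\delta}}\right).$$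
   Context: The complete problem is $P:\ \min\{\mathbf c^T\mathbf x\mid \mathbf A\mathbf x=\mathbf b,\ \mathbf x\ge \mathbf 0\}$ with $\mathbf A\in\mathbb R^{m\times n}$, $\mathbf b\in\mathbb R^m$, $\mathbf c\in\mathbb R^n$. Standing assumptions: $P$ is feasible and bounded, $\mathrm{rank}(\mathbf A)=m$, and $\|\mathbf c\|_2=1$. $\mathbf A_j$ denotes the $j$th column of $\mathbf A$. A basis is a set $B\subseteq[n]=\{1,\dots,n\}$ with $|B|=m$ and $\mathbf A_B$ nonsingular. The corresponding basic solution of $P$ (not necessarily feasible) has $\mathbf x_B=\mathbf A_B^{-1}\mathbf b$ and all other components zero, and the reduced cost vector of the basis is $\bar{\mathbf c}=\mathbf c^T-\mathbf c_B^T\mathbf A_B^{-1}\mathbf A$. $\boldsymbol\xi=(\xi_1,\dots,\xi_n)$ is a probability distribution on $[n]$. The indices $j_1,\dots,j_K\in[n]$ are independent with $\Pr[j_k=t]=\xi_t$ (repetitions possible). $\mathbf A_J$ is the matrix with columns $\mathbf A_{j_1},\dots,\mathbf A_{j_K}$, $\mathbf c_J=(c_{j_1},\dots,c_{j_K})$, and $P_J:\ \min\{\mathbf c_J^T\tilde{\mathbf x}\mid \mathbf A_J\tilde{\mathbf x}=\mathbf b,\ \tilde{\mathbf x}\ge\mathbf 0\}$. $v(\cdot)$ denotes the optimal value of a problem, with $v=+\infty$ for an infeasible minimization problem, and $\Delta v(P'')=v(P'')-v(P)$. *)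

theory Defs
  imports "HOL-Probability.Probability"
begin

text \<open>
  A linear program in standard form is given by \<open>A :: real^'n^'m\<close>, \<open>b :: real^'m\<close>, \<open>c :: real^'n\<close>;
  the dimensions are \<open>m = CARD('m)\<close> and \<open>n = CARD('n)\<close>. The order on \<open>real^'n\<close> is componentwise.
\<close>

definition std_feasible :: "real^'n^'m \<Rightarrow> real^'m \<Rightarrow> (real^'n) set" where
  "std_feasible A b = {x. A *v x = b \<and> 0 \<le> x}"

definition distr_feasible :: "real^'n^'m \<Rightarrow> real^'m \<Rightarrow> real \<Rightarrow> real^'n \<Rightarrow> (real^'n) set" where
  "distr_feasible A b C \<xi> = {x. A *v x = b \<and> 0 \<le> x \<and> x \<le> C *\<^sub>R \<xi>}"

text \<open>The value is \<open>\<infinity>\<close> for an empty feasible set and \<open>-\<infinity>\<close> for an unbounded problem.\<close>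

definition opt_value :: "real^'n \<Rightarrow> (real^'n) set \<Rightarrow> ereal" where
  "opt_value c S = (INF x\<in>S. ereal (c \<bullet> x))"

text \<open>
  Selection of columns and components along an index map, in which indices may repeat:
  it is used with a sample \<open>J\<close> (index type of size \<open>K\<close>) and with an enumeration of a basis.
\<close>

definition sel_cols :: "real^'n^'m \<Rightarrow> ('k \<Rightarrow> 'n) \<Rightarrow> real^'k^'m" where
  "sel_cols A \<sigma> = (\<chi> i k. A $ i $ \<sigma> k)"

definition sel_vec :: "real^'n \<Rightarrow> ('k \<Rightarrow> 'n) \<Rightarrow> real^'k" where
  "sel_vec v \<sigma> = (\<chi> k. v $ \<sigma> k)"

text \<open>
  To view the columns in an index set \<open>B\<close> with \<open>card B = CARD('m)\<close> as a square matrix, \<open>B\<close> is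
  enumerated by \<open>'m\<close>. Invertibility of the basis matrix, the basic solution and the reduced costs
  do not depend on the chosen enumeration.
\<close>

definition basis_enum :: "'n set \<Rightarrow> 'm::finite \<Rightarrow> 'n" where
  "basis_enum B = (SOME \<sigma>. bij_betw \<sigma> UNIV B)"

definition basis_matrix :: "real^'n^'m \<Rightarrow> 'n set \<Rightarrow> real^'m^'m" where
  "basis_matrix A B = sel_cols A (basis_enum B)"

definition is_basis :: "real^'n^'m \<Rightarrow> 'n set \<Rightarrow> bool" where
  "is_basis A B \<longleftrightarrow> card B = CARD('m) \<and> invertible (basis_matrix A B)"

definition is_basic_solution :: "real^'n^'m \<Rightarrow> real^'m \<Rightarrow> 'n set \<Rightarrow> real^'n \<Rightarrow> bool" where
  "is_basic_solution A b B x \<longleftrightarrow> is_basis A B \<and>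
     sel_vec x (basis_enum B) = matrix_inv (basis_matrix A B) *v b \<and> (\<forall>t. t \<notin> B \<longrightarrow> x $ t = 0)"

definition reduced_cost :: "real^'n^'m \<Rightarrow> real^'n \<Rightarrow> 'n set \<Rightarrow> real^'n" where
  "reduced_cost A c B =
     c - (sel_vec c (basis_enum B) v* matrix_inv (basis_matrix A B)) v* A"

text \<open>
  The gap of a value \<open>v\<close> to that of the complete problem; whenever the latter is finite,
  this is an ordinary difference, with gap \<open>\<infinity>\<close> for \<open>v = \<infinity>\<close>.
\<close>

definition value_gap :: "real^'n^'m \<Rightarrow> real^'m \<Rightarrow> real^'n \<Rightarrow> ereal \<Rightarrow> ereal" where
  "value_gap A b c v = v - opt_value c (std_feasible A b)"

end

(*
Every real r below the value of the sampled problem lies below p.b for some vertex p of the sampled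
dual polyhedron {p. p A_J <= c_J}: a dual point beyond r comes from separating (b, r) from the closed
cone of attainable pairs (right-hand side, cost), and moving it to a vertex does not decrease p.b.
The tight columns at p contain a basis B of A whose reduced costs d = c - p A are nonnegative on J.
For an optimal x of the distributional problem and any y >= 0 supported on J this gives
r < p.A x = c.x + d.(y - x) - d.y <= c.x + chi * |y - x|.
Taking for y the importance sampling estimate (1/K) sum_k (x_{j_k} / xi_{j_k}) e_{j_k} of x,
whose summands have norm at most C, the error |y - x| has mean at most C / sqrt K (second moment)
and, by McDiarmid's inequality, exceeds its mean by C sqrt (2 ln (1/delta) / K) with probability
at most delta.
*)
theory Submission imports Defs begin

subsection \<open>Dual vertices of linear programs\<close>

lemma inner_vec_nonneg:
  fixes x y :: "real^'n"
  assumes "0 \<le> x" "0 \<le> y"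
  shows "0 \<le> x \<bullet> y"
  using assms by (auto simp: inner_vec_def less_eq_vec_def intro!: sum_nonneg)

lemma vector_matrix_mult_nth:
  fixes A :: "real^'n^'m"
  shows "(p v* A) $ k = p \<bullet> column k A"
  by (simp add: vector_matrix_mult_def inner_vec_def column_def mult.commute)

text \<open>The slack \<open>s\<close> closes the set upwards in the cost: it pairs each attainable
  right-hand side with every number at or above a cost attaining it. Being a convex cone, it
  contains the conic hull of any generators that lie in it.\<close>

lemma convex_cone_lp_values:
  fixes A :: "real^'n^'m"
  shows "convex_cone {(A *v x, c \<bullet> x + s) | x s. 0 \<le> x \<and> 0 \<le> s}" (is "convex_cone ?T")
  unfolding convex_cone_iff
proof (intro conjI ballI allI impI)
  show "0 \<in> ?T"
    by (auto simp: zero_prod_def intro!: exI[of _ 0])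
next
  fix u w assume "u \<in> ?T" "w \<in> ?T"
  then obtain x s y t where u: "u = (A *v x, c \<bullet> x + s)" "0 \<le> x" "0 \<le> s"
      and w: "w = (A *v y, c \<bullet> y + t)" "0 \<le> y" "0 \<le> t"
    by auto
  have "u + w = (A *v (x + y), c \<bullet> (x + y) + (s + t))"
    using u w by (simp add: matrix_vector_right_distrib inner_add_right)
  moreover have "0 \<le> x + y" "0 \<le> s + t"
    using u w by (auto simp: less_eq_vec_def)
  ultimately show "u + w \<in> ?T"
    by blast
next
  fix u and r :: real assume "u \<in> ?T" "0 \<le> r"
  then obtain x s where u: "u = (A *v x, c \<bullet> x + s)" "0 \<le> x" "0 \<le> s"
    by auto
  have "r *\<^sub>R u = (A *v (r *\<^sub>R x), c \<bullet> (r *\<^sub>R x) + r * s)"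
    using u by (simp add: matrix_vector_mult_scaleR algebra_simps)
  moreover have "0 \<le> r *\<^sub>R x" "0 \<le> r * s"
    using u \<open>0 \<le> r\<close> by (auto simp: less_eq_vec_def)
  ultimately show "r *\<^sub>R u \<in> ?T"
    by blast
qed

text \<open>A Farkas argument: \<open>(b, r)\<close> lies outside the cone of right-hand sides and
  costs, so a hyperplane with normal \<open>(u, q)\<close> separates them. Feasibility excludes
  \<open>q = 0\<close>, and rescaling \<open>u\<close> yields the dual point.\<close>

lemma dual_value_above:
  fixes A :: "real^'n^'m" and b :: "real^'m" and c :: "real^'n"
  assumes ne: "std_feasible A b \<noteq> {}"
    and r: "\<And>x. x \<in> std_feasible A b \<Longrightarrow> r < c \<bullet> x"
  shows "\<exists>p. p v* A \<le> c \<and> r < p \<bullet> b"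
proof -
  \<comment> \<open>The generators are the columns with their costs and the slack direction
    \<open>(0, 1)\<close>. Finiteness of \<open>S\<close> makes the conic hull closed, as strict
    separation requires; \<open>T\<close> contains this hull and excludes
    \<open>(b, r)\<close>.\<close>
  define S where "S = insert (0, 1) (range (\<lambda>k. (column k A, c $ k)))"
  define T where "T = {(A *v x, c \<bullet> x + s) | x s. 0 \<le> x \<and> 0 \<le> s}"
  have "S \<subseteq> T"
  proof -
    have "(0, 1) \<in> T"
      unfolding T_def by (auto intro!: exI[of _ "0 :: real^'n"])
    moreover have "(column k A, c $ k) \<in> T" for k
      unfolding T_def mem_Collect_eq
      by (intro exI[of _ "axis k 1"] exI[of _ 0])
         (simp add: matrix_vector_mult_basis inner_axis less_eq_vec_def, simp add: axis_def)
    ultimately show ?thesis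
      by (auto simp: S_def)
  qed
  then have hull: "convex_cone hull S \<subseteq> T"
    unfolding T_def by (intro hull_minimal convex_cone_lp_values)
  have "(b, r) \<notin> T"
  proof
    assume "(b, r) \<in> T"
    then obtain x s where x: "b = A *v x" "r = c \<bullet> x + s" "0 \<le> x" "0 \<le> s"
      by (auto simp: T_def)
    with r[of x] show False
      by (simp add: std_feasible_def)
  qed
  with hull have "(b, r) \<notin> convex_cone hull S"
    by blast
  moreover have "finite S"
    by (simp add: S_def)
  ultimately obtain a \<beta> where a: "a \<bullet> (b, r) < \<beta>" "\<And>y. y \<in> convex_cone hull S \<Longrightarrow> \<beta> < a \<bullet> y"
    using separating_hyperplane_closed_point[OF convex_convex_cone_hull closed_convex_cone_hull]
    by metis
  obtain u q where uq: "a = (u, q)"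
    by force
  have "\<beta> < 0"
    using a(2)[OF convex_cone_hull_contains_0] by simp
  \<comment> \<open>If \<open>a\<close> were negative on a generator, the positive multiple of it
    with factor \<open>\<beta> / (a \<bullet> y)\<close> would stay in the cone and attain the value
    \<open>\<beta>\<close> exactly, against the strict bound.\<close>
  have nonneg: "0 \<le> a \<bullet> y" if "y \<in> S" for y
  proof (rule ccontr)
    assume neg: "\<not> 0 \<le> a \<bullet> y"
    have "(\<beta> / (a \<bullet> y)) *\<^sub>R y \<in> convex_cone hull S"
      using neg \<open>\<beta> < 0\<close> by (intro convex_cone_hull_mul hull_inc that) (simp add: divide_nonpos_neg)
    from a(2)[OF this] neg show False
      by simp
  qed
  have q: "0 \<le> q"
    using nonneg[of "(0, 1)"] by (simp add: S_def uq)
  have col: "0 \<le> u \<bullet> column k A + q * c $ k" for k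
    using nonneg[of "(column k A, c $ k)"] by (simp add: S_def uq)
  have ub: "u \<bullet> b + q * r < 0"
    using a(1) \<open>\<beta> < 0\<close> by (simp add: uq)
  \<comment> \<open>With \<open>q = 0\<close> the vector \<open>u\<close> would certify
    infeasibility: \<open>u v* A\<close> is nonnegative while \<open>u \<bullet> b\<close> is
    negative.\<close>
  have "q \<noteq> 0"
  proof
    assume "q = 0"
    obtain x where x: "A *v x = b" "0 \<le> x"
      using ne by (auto simp: std_feasible_def)
    have "0 \<le> (u v* A) \<bullet> x"
      using col \<open>q = 0\<close> x by (intro inner_vec_nonneg) (auto simp: less_eq_vec_def vector_matrix_mult_nth)
    with x ub \<open>q = 0\<close> show False
      by (simp add: dot_lmul_matrix)
  qed
  with q have "0 < q"
    by simp
  \<comment> \<open>Normalizes the cost coefficient to 1; the sign turns nonnegativity of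
    \<open>u v* A + q *\<^sub>R c\<close> into dual feasibility.\<close>
  define p where "p = - (1 / q) *\<^sub>R u"
  have "p v* A \<le> c"
    unfolding less_eq_vec_def
  proof
    fix k
    show "(p v* A) $ k \<le> c $ k"
      using col[of k] \<open>0 < q\<close> by (simp add: vector_matrix_mult_nth p_def field_simps)
  qed
  moreover have "r < p \<bullet> b"
    using ub \<open>0 < q\<close> by (simp add: p_def field_simps)
  ultimately show ?thesis
    by blast
qed

text \<open>Weak duality for recession directions of the dual polyhedron: at any feasible
  \<open>x\<close>, \<open>d \<bullet> b\<close> equals \<open>(d v* A) \<bullet> x\<close>.\<close>

lemma dual_direction_nonpos:
  fixes A :: "real^'n^'m"
  assumes "std_feasible A b \<noteq> {}" "d v* A \<le> 0"
  shows "d \<bullet> b \<le> 0"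
proof -
  obtain x where x: "A *v x = b" "0 \<le> x"
    using assms by (auto simp: std_feasible_def)
  have "0 \<le> (- (d v* A)) \<bullet> x"
    using assms(2) x by (intro inner_vec_nonneg) (auto simp: less_eq_vec_def)
  with x show ?thesis
    by (simp add: dot_lmul_matrix)
qed

text \<open>Among the dual points beyond \<open>r\<close>, one with the most tight constraints is
  taken. If its tight columns did not span, a move orthogonal to them that does not decrease the
  dual objective would reach a further tight constraint. Spanning tight columns are what makes the
  point a vertex.\<close>

lemma dual_vertex_above:
  fixes A :: "real^'n^'m" and b :: "real^'m" and c :: "real^'n"
  assumes ne: "std_feasible A b \<noteq> {}" and rank: "rank A = CARD('m)"
    and r: "\<And>x. x \<in> std_feasible A b \<Longrightarrow> r < c \<bullet> x"
  shows "\<exists>p. p v* A \<le> c \<and> r < p \<bullet> b \<and> span {column k A | k. (p v* A) $ k = c $ k} = UNIV"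
proof -
  define tight where "tight p = {k. (p v* A) $ k = c $ k}" for p
  define D where "D = {p. p v* A \<le> c \<and> r < p \<bullet> b}"
  obtain p0 where "p0 \<in> D"
    using dual_value_above[OF ne r] by (auto simp: D_def)
  then obtain p where p: "p \<in> D" "\<And>q. q \<in> D \<Longrightarrow> card (tight q) \<le> card (tight p)"
    using ex_has_greatest_nat[of "\<lambda>p. p \<in> D" p0 "\<lambda>p. card (tight p)" "Suc (CARD('n))"]
    by (auto simp: less_Suc_eq_le card_mono)
  have pc: "(p v* A) $ k \<le> c $ k" for k
    using p(1) by (auto simp: D_def less_eq_vec_def)
  let ?U = "span {column k A | k. k \<in> tight p}"
  have "?U = UNIV"
  proof (rule ccontr)
    assume "?U \<noteq> UNIV"
    then have "?U \<subset> span UNIV"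
      by auto
    then obtain d0 where d0: "d0 \<noteq> 0" "\<And>y. y \<in> ?U \<Longrightarrow> orthogonal d0 y"
      using orthogonal_to_subspace_exists_gen by blast
    have "\<exists>d. d \<noteq> 0 \<and> (\<forall>y\<in>?U. orthogonal d y) \<and> 0 \<le> d \<bullet> b \<and> (\<exists>k. 0 < (d v* A) $ k)"
    proof -
      \<comment> \<open>Full rank makes \<open>A\<close> surjective, so \<open>d0 = A *v y\<close>;
        if \<open>d0 v* A\<close> vanished, \<open>d0\<close> would be orthogonal to itself.\<close>
      have "\<not> (\<forall>k. (d0 v* A) $ k = 0)"
      proof
        assume "\<forall>k. (d0 v* A) $ k = 0"
        then have "d0 v* A = 0"
          by (simp add: vec_eq_iff)
        moreover obtain y where "d0 = A *v y"
          using rank full_rank_surjective[of A] by (metis surjD)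
        ultimately have "d0 \<bullet> d0 = 0"
          by (metis dot_lmul_matrix inner_zero_left)
        with d0 show False
          by simp
      qed
      then obtain k0 where k0: "(d0 v* A) $ k0 \<noteq> 0"
        by blast
      \<comment> \<open>The sign is dictated by the objective when \<open>d0 \<bullet> b\<close> is
        nonzero; a positive entry of \<open>d v* A\<close> then exists because an
        objective-increasing direction cannot be a recession direction. When
        \<open>d0 \<bullet> b = 0\<close> the sign is free and is chosen to make entry
        \<open>k0\<close> positive.\<close>
      define d where "d = (if 0 < d0 \<bullet> b \<or> d0 \<bullet> b = 0 \<and> 0 < (d0 v* A) $ k0 then d0 else - d0)"
      have 1: "d \<noteq> 0" "\<forall>y\<in>?U. orthogonal d y" "0 \<le> d \<bullet> b"
        using d0 by (auto simp: d_def orthogonal_def)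
      moreover have "\<exists>k. 0 < (d v* A) $ k"
      proof (cases "d0 \<bullet> b = 0")
        case True
        then have "0 < (d v* A) $ k0"
          using k0 by (auto simp: d_def vector_matrix_mult_nth)
        then show ?thesis ..
      next
        case False
        then have "\<not> d v* A \<le> 0"
          using dual_direction_nonpos[OF ne, of d] 1 by (auto simp: d_def split: if_splits)
        then show ?thesis
          by (auto simp: less_eq_vec_def not_le)
      qed
      ultimately show ?thesis
        by blast
    qed
    then obtain d k1 where d: "\<And>y. y \<in> ?U \<Longrightarrow> orthogonal d y" "0 \<le> d \<bullet> b" "0 < (d v* A) $ k1"
      by blast
    define P where "P = {k. 0 < (d v* A) $ k}"
    \<comment> \<open>Ratio test: \<open>\<rho> k\<close> is the step at which constraint
      \<open>k\<close> becomes tight, and the minimum over \<open>P\<close> is the longest step that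
      keeps dual feasibility.\<close>
    define \<rho> where "\<rho> k = (c $ k - (p v* A) $ k) / (d v* A) $ k" for k
    define \<theta> where "\<theta> = Min (\<rho> ` P)"
    have "P \<noteq> {}"
      using d by (auto simp: P_def)
    then have "\<theta> \<in> \<rho> ` P"
      unfolding \<theta>_def by (intro Min_in) auto
    then obtain k2 where k2: "k2 \<in> P" "\<theta> = \<rho> k2"
      by blast
    have \<theta>_le: "\<theta> \<le> \<rho> k" if "k \<in> P" for k
      using that by (simp add: \<theta>_def)
    have "0 \<le> \<theta>"
      using k2 pc[of k2] by (simp add: \<rho>_def P_def)
    define q where "q = p + \<theta> *\<^sub>R d"
    have q_nth: "(q v* A) $ k = (p v* A) $ k + \<theta> * (d v* A) $ k" for k
      by (simp add: q_def vector_matrix_mult_nth inner_add_left)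
    have "(q v* A) $ k \<le> c $ k" for k
    proof (cases "k \<in> P")
      case True
      then show ?thesis
        using \<theta>_le[OF True] by (simp add: q_nth \<rho>_def P_def field_simps)
    next
      case False
      then have "\<theta> * (d v* A) $ k \<le> 0"
        using \<open>0 \<le> \<theta>\<close> by (simp add: P_def mult_nonneg_nonpos)
      with pc[of k] show ?thesis
        by (simp add: q_nth)
    qed
    moreover have "r < q \<bullet> b"
      using p(1) mult_nonneg_nonneg[OF \<open>0 \<le> \<theta>\<close> d(2)] by (simp add: D_def q_def inner_add_left)
    ultimately have "q \<in> D"
      by (simp add: D_def less_eq_vec_def)
    have orth: "(d v* A) $ k = 0" if "k \<in> tight p" for k
      using d(1)[of "column k A"] that
      by (auto simp: orthogonal_def vector_matrix_mult_nth intro: span_base)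
    have "tight p \<subseteq> tight q"
      using orth by (auto simp: q_nth) (auto simp: tight_def q_nth)
    \<comment> \<open>The blocking index is new: \<open>d v* A\<close> is positive at
      \<open>k2\<close> but vanishes on all indices tight at \<open>p\<close>.\<close>
    moreover have "k2 \<in> tight q" "k2 \<notin> tight p"
      using k2 orth[of k2] by (auto simp: tight_def q_nth \<rho>_def P_def)
    ultimately have "tight p \<subset> tight q"
      by blast
    then have "card (tight p) < card (tight q)"
      by (intro psubset_card_mono) auto
    with p(2)[OF \<open>q \<in> D\<close>] show False
      by simp
  qed
  with p(1) show ?thesis
    by (auto simp: D_def tight_def)
qed

section \<open>Bases of the column matrix and their reduced costs\<close>

lemma bij_betw_basis_enum:
  assumes "card B = CARD('m)"
  shows "bij_betw (basis_enum B :: 'm::finite \<Rightarrow> 'n::finite) UNIV B"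
proof -
  have "\<exists>\<sigma> :: 'm \<Rightarrow> 'n. bij_betw \<sigma> UNIV B"
    using assms by (intro finite_same_card_bij) auto
  then show ?thesis
    unfolding basis_enum_def by (rule someI_ex)
qed

lemma ex_basis_subset:
  fixes A :: "real^'n^'m"
  assumes "span {column t A | t. t \<in> T} = UNIV"
  shows "\<exists>B\<subseteq>T. is_basis A B"
proof -
  let ?S = "(\<lambda>t. column t A) ` T"
  have eq: "?S = {column t A | t. t \<in> T}"
    by auto
  obtain V where V: "V \<subseteq> ?S" "independent V" "?S \<subseteq> span V" "card V = dim ?S"
    using basis_exists by blast
  have dimS: "dim ?S = CARD('m)"
    using dim_span[of ?S] assms by (simp add: eq dim_UNIV)
  \<comment> \<open>Different indices may carry equal columns; one index per vector of
    \<open>V\<close> is kept, so that \<open>B\<close> has exactly as many elements as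
    \<open>V\<close>.\<close>
  obtain B where B: "B \<subseteq> T" "inj_on (\<lambda>t. column t A) B" "V = (\<lambda>t. column t A) ` B"
    using V(1) by (meson subset_image_inj)
  have card: "card B = CARD('m)"
    using B V dimS by (simp add: card_image)
  let ?M = "basis_matrix A B"
  have bij: "bij_betw (basis_enum B :: 'm \<Rightarrow> 'n) UNIV B"
    using card by (rule bij_betw_basis_enum)
  have "columns ?M = range (\<lambda>i. column i ?M)"
    by (auto simp: columns_def)
  also have "\<dots> = (\<lambda>t. column t A) ` range (basis_enum B :: 'm \<Rightarrow> 'n)"
    by (simp add: image_image basis_matrix_def sel_cols_def column_def)
  also have "\<dots> = V"
    using bij B(3) by (auto simp: bij_betw_def)
  finally have "columns ?M = V" .
  moreover have "span V = UNIV"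
    using V(3) assms eq by (metis span_mono span_span top.extremum_uniqueI)
  ultimately have "invertible ?M"
    using matrix_right_invertible_span_columns[of ?M]
    by (simp add: invertible_right_inverse span_vec_eq)
  with card B(1) show ?thesis
    by (auto simp: is_basis_def)
qed

text \<open>The bound \<open>chi\<close> is assumed for basic solutions, so this makes it available
  for every basis.\<close>

lemma ex_basic_solution:
  assumes "is_basis A B"
  shows "\<exists>x. is_basic_solution A b B x"
proof -
  define \<sigma> where "\<sigma> = (basis_enum B :: 'b \<Rightarrow> 'a)"
  have bij: "bij_betw \<sigma> UNIV B"
    using assms unfolding \<sigma>_def is_basis_def by (intro bij_betw_basis_enum) simp
  define x where "x = (\<chi> t. if t \<in> B then (matrix_inv (basis_matrix A B) *v b) $ inv \<sigma> t else 0)"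
  have "inj \<sigma>" "\<And>i. \<sigma> i \<in> B"
    using bij by (auto simp: bij_betw_def)
  then have "sel_vec x \<sigma> = matrix_inv (basis_matrix A B) *v b"
    by (simp add: vec_eq_iff sel_vec_def x_def)
  then have "is_basic_solution A b B x"
    using assms by (simp add: is_basic_solution_def x_def \<sigma>_def)
  then show ?thesis ..
qed

text \<open>Tightness on \<open>B\<close> says that \<open>p\<close> solves the square system of the
  basis, so \<open>p\<close> is the multiplier vector in the definition of the reduced cost. The
  slack of a dual vertex is thereby a reduced cost vector.\<close>

lemma reduced_cost_eq:
  fixes A :: "real^'n^'m"
  assumes basis: "is_basis A B" and tight: "\<And>t. t \<in> B \<Longrightarrow> (p v* A) $ t = c $ t"
  shows "reduced_cost A c B = c - p v* A"
proof -
  define \<sigma> where "\<sigma> = (basis_enum B :: 'm \<Rightarrow> 'n)"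
  let ?M = "basis_matrix A B"
  have "bij_betw \<sigma> UNIV B"
    using basis unfolding \<sigma>_def is_basis_def by (intro bij_betw_basis_enum) simp
  then have "\<sigma> i \<in> B" for i
    by (auto simp: bij_betw_def)
  then have "p \<bullet> column (\<sigma> i) A = c $ \<sigma> i" for i
    using tight by (simp add: vector_matrix_mult_nth)
  moreover have "(p v* ?M) $ i = p \<bullet> column (\<sigma> i) A" for i
    by (simp add: vector_matrix_mult_nth basis_matrix_def sel_cols_def column_def \<sigma>_def)
  ultimately have "p v* ?M = sel_vec c \<sigma>"
    by (simp add: vec_eq_iff sel_vec_def)
  then have "sel_vec c \<sigma> v* matrix_inv ?M = (p v* ?M) v* matrix_inv ?M"
    by simp
  also have "\<dots> = p"
    \<comment> \<open>\<open>matrix_inv\<close> is defined by choice; invertibility guarantees that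
      the chosen matrix is a two-sided inverse.\<close>
    using basis someI_ex[of "\<lambda>A'. ?M ** A' = mat 1 \<and> A' ** ?M = mat 1"]
    by (simp only: vector_matrix_mul_assoc is_basis_def invertible_def matrix_inv_def) simp
  finally show ?thesis
    by (simp add: reduced_cost_def \<sigma>_def)
qed

text \<open>The basis found at a dual vertex of the sampled problem consists of columns of
  \<open>A\<close>, hence is a basis of the complete problem. Sampled dual feasibility controls the
  sign of the reduced costs on \<open>range J\<close> only. Working with any \<open>r\<close> below
  the value avoids attainment of the sampled optimum.\<close>

lemma sampled_value_above:
  fixes A :: "real^'n^'m" and b :: "real^'m" and c :: "real^'n" and J :: "'k::finite \<Rightarrow> 'n"
  assumes ne: "std_feasible (sel_cols A J) b \<noteq> {}" and rank: "rank (sel_cols A J) = CARD('m)"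
    and r: "ereal r < opt_value (sel_vec c J) (std_feasible (sel_cols A J) b)"
  shows "\<exists>B p. is_basis A B \<and> reduced_cost A c B = c - p v* A \<and>
           (\<forall>t\<in>range J. 0 \<le> reduced_cost A c B $ t) \<and> r < p \<bullet> b"
proof -
  have r': "r < sel_vec c J \<bullet> x" if "x \<in> std_feasible (sel_cols A J) b" for x
    using r less_INF_D[OF _ that] unfolding opt_value_def by fastforce
  have nth: "(p v* sel_cols A J) $ k = (p v* A) $ J k" for p k
    by (simp add: vector_matrix_mult_nth sel_cols_def column_def)
  obtain p where p: "p v* sel_cols A J \<le> sel_vec c J" "r < p \<bullet> b"
    "span {column k (sel_cols A J) | k. (p v* sel_cols A J) $ k = sel_vec c J $ k} = UNIV"
    using dual_vertex_above[OF ne rank r'] by blast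
  let ?T = "{t \<in> range J. (p v* A) $ t = c $ t}"
  \<comment> \<open>Repeated draws collapse here: positions in the sample are replaced by the
    original indices in \<open>range J\<close>.\<close>
  have "{column k (sel_cols A J) | k. (p v* sel_cols A J) $ k = sel_vec c J $ k}
      = {column t A | t. t \<in> ?T}"
    unfolding nth by (auto simp: sel_vec_def sel_cols_def column_def)
  with p(3) have "span {column t A | t. t \<in> ?T} = UNIV"
    by simp
  from ex_basis_subset[OF this] obtain B where B: "B \<subseteq> ?T" "is_basis A B"
    by blast
  have rc: "reduced_cost A c B = c - p v* A"
    by (rule reduced_cost_eq[OF B(2)]) (use B(1) in blast)
  have "(p v* A) $ J k \<le> c $ J k" for k
    using p(1) by (simp add: less_eq_vec_def nth sel_vec_def)
  then have "\<forall>t\<in>range J. 0 \<le> reduced_cost A c B $ t"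
    by (simp add: rc)
  with rc B(2) p(2) show ?thesis
    by blast
qed

subsection \<open>Concentration for independent samples from a finite type\<close>

lemma integrable_pmf_finite_type [simp]:
  fixes f :: "'a::finite \<Rightarrow> 'b::{banach, second_countable_topology}"
  shows "integrable (measure_pmf p) f"
  by (intro integrable_measure_pmf_finite) simp

text \<open>An oscillation bound stands in for an interval: the minimum \<open>a\<close> of
  \<open>f\<close> is attained on a finite type, so \<open>f\<close> takes values between
  \<open>a\<close> and \<open>a + d\<close>.\<close>

lemma Hoeffdings_lemma_pmf:
  fixes f :: "'a::finite \<Rightarrow> real"
  assumes "0 < l" and d: "\<And>x y. \<bar>f x - f y\<bar> \<le> d"
  shows "measure_pmf.expectation p (\<lambda>x. exp (l * f x))
    \<le> exp (l * measure_pmf.expectation p f + l\<^sup>2 * d\<^sup>2 / 8)"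
proof -
  let ?E = "measure_pmf.expectation p f"
  define a where "a = Min (range f)"
  have "a \<in> range f"
    unfolding a_def by (intro Min_in) auto
  then obtain x0 where x0: "a = f x0"
    by blast
  have "a \<le> f x" for x
    by (simp add: a_def)
  moreover have "f x \<le> a + d" for x
    using d[of x x0] x0 by linarith
  ultimately interpret interval_bounded_random_variable "measure_pmf p" f a "a + d"
    by unfold_locales auto
  have "ennreal (measure_pmf.expectation p (\<lambda>x. exp (l * (f x - ?E))))
      = (\<integral>\<^sup>+x. exp (l * (f x - ?E)) \<partial>measure_pmf p)"
    by (intro nn_integral_eq_integral[symmetric]) auto
  also have "\<dots> \<le> ennreal (exp (l\<^sup>2 * d\<^sup>2 / 8))"
    using Hoeffdings_lemma_nn_integral[OF \<open>0 < l\<close>] by simp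
  finally have *: "measure_pmf.expectation p (\<lambda>x. exp (l * (f x - ?E))) \<le> exp (l\<^sup>2 * d\<^sup>2 / 8)"
    by simp
  have "measure_pmf.expectation p (\<lambda>x. exp (l * f x))
      = measure_pmf.expectation p (\<lambda>x. exp (l * ?E) * exp (l * (f x - ?E)))"
    by (simp add: exp_add[symmetric] algebra_simps)
  also have "\<dots> = exp (l * ?E) * measure_pmf.expectation p (\<lambda>x. exp (l * (f x - ?E)))"
    by simp
  also have "\<dots> \<le> exp (l * ?E) * exp (l\<^sup>2 * d\<^sup>2 / 8)"
    using * by (intro mult_left_mono) auto
  finally show ?thesis
    by (simp add: exp_add)
qed

text \<open>Fubini for one coordinate split off from the product; it drives the inductions over the
  index set.\<close>

lemma expectation_Pi_pmf_insert:
  fixes f :: "('k::finite \<Rightarrow> 'a::finite) \<Rightarrow> real"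
  assumes "k \<notin> S"
  shows "measure_pmf.expectation (Pi_pmf (insert k S) z p) f
    = measure_pmf.expectation (Pi_pmf S z p) (\<lambda>g. measure_pmf.expectation (p k) (\<lambda>y. f (g(k := y))))"
proof -
  have sum_pmf: "measure_pmf.expectation q h = (\<Sum>y\<in>UNIV. h y * pmf q y)"
    for q :: "'b::finite pmf" and h :: "'b \<Rightarrow> real"
    by (rule integral_measure_pmf_real) auto
  have "measure_pmf.expectation (Pi_pmf (insert k S) z p) f
      = measure_pmf.expectation (pair_pmf (p k) (Pi_pmf S z p)) (\<lambda>(y, g). f (g(k := y)))"
    using assms by (subst Pi_pmf_insert) (auto simp: integral_map_pmf case_prod_unfold)
  also have "\<dots> = (\<Sum>y\<in>UNIV. \<Sum>g\<in>UNIV. f (g(k := y)) * (pmf (p k) y * pmf (Pi_pmf S z p) g))"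
    by (subst integral_measure_pmf_real[of UNIV])
       (auto simp: sum.cartesian_product pmf_pair case_prod_unfold intro!: sum.cong)
  also have "\<dots> = (\<Sum>g\<in>UNIV. \<Sum>y\<in>UNIV. f (g(k := y)) * (pmf (p k) y * pmf (Pi_pmf S z p) g))"
    by (rule sum.swap)
  also have "\<dots> = measure_pmf.expectation (Pi_pmf S z p)
      (\<lambda>g. measure_pmf.expectation (p k) (\<lambda>y. f (g(k := y))))"
    unfolding sum_pmf by (simp add: sum_distrib_right mult.assoc)
  finally show ?thesis .
qed

text \<open>Coordinates are averaged out one at a time. With the others fixed, Hoeffding's lemma in
  coordinate \<open>k\<close> costs a factor \<open>exp (l\<^sup>2 * (d k)\<^sup>2 / 8)\<close>, and
  the averaged function \<open>?h\<close> inherits the bounded differences.\<close>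

lemma McDiarmid_exp_moment:
  fixes f :: "('k::finite \<Rightarrow> 'a::finite) \<Rightarrow> real"
  assumes "0 < l" and d: "\<And>g k x y. \<bar>f (g(k := x)) - f (g(k := y))\<bar> \<le> d k"
  shows "measure_pmf.expectation (Pi_pmf S z p) (\<lambda>g. exp (l * f g))
    \<le> exp (l * measure_pmf.expectation (Pi_pmf S z p) f + l\<^sup>2 * (\<Sum>k\<in>S. (d k)\<^sup>2) / 8)"
  using finite[of S] d
proof (induction S arbitrary: f rule: finite_induct)
  case empty
  then show ?case
    by simp
next
  case (insert k S)
  let ?h = "\<lambda>g. measure_pmf.expectation (p k) (\<lambda>y. f (g(k := y)))"
  have h: "\<bar>?h (g(i := x)) - ?h (g(i := y))\<bar> \<le> d i" for g i x y
  proof -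
    have nonneg: "0 \<le> d i"
      using insert.prems[of g i x x] by simp
    have *: "\<bar>f ((g(i := x))(k := u)) - f ((g(i := y))(k := u))\<bar> \<le> d i" for u
    \<comment> \<open>For \<open>i = k\<close> the later update overwrites both changes, so the
      difference is zero; otherwise the updates commute.\<close>
    proof (cases "i = k")
      case True
      then show ?thesis using nonneg by simp
    next
      case False
      then have "(g(i := w))(k := u) = (g(k := u))(i := w)" for w
        by (simp add: fun_upd_twist)
      then show ?thesis
        using insert.prems[of "g(k := u)" i x y] by (simp only:)
    qed
    have "?h (g(i := x)) - ?h (g(i := y))
        = measure_pmf.expectation (p k) (\<lambda>u. f ((g(i := x))(k := u)) - f ((g(i := y))(k := u)))"
      by simp
    also have "\<bar>\<dots>\<bar> \<le> measure_pmf.expectation (p k)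
        (\<lambda>u. \<bar>f ((g(i := x))(k := u)) - f ((g(i := y))(k := u))\<bar>)"
      by (rule integral_abs_bound)
    also have "\<dots> \<le> d i"
      using * by (intro measure_pmf.integral_le_const) auto
    finally show ?thesis .
  qed
  have "measure_pmf.expectation (Pi_pmf (insert k S) z p) (\<lambda>g. exp (l * f g))
      = measure_pmf.expectation (Pi_pmf S z p)
          (\<lambda>g. measure_pmf.expectation (p k) (\<lambda>y. exp (l * f (g(k := y)))))"
    using insert.hyps by (simp add: expectation_Pi_pmf_insert)
  also have "\<dots> \<le> measure_pmf.expectation (Pi_pmf S z p) (\<lambda>g. exp (l * ?h g + l\<^sup>2 * (d k)\<^sup>2 / 8))"
    by (intro integral_mono Hoeffdings_lemma_pmf \<open>0 < l\<close> insert.prems) simp_all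
  also have "\<dots> = exp (l\<^sup>2 * (d k)\<^sup>2 / 8) * measure_pmf.expectation (Pi_pmf S z p) (\<lambda>g. exp (l * ?h g))"
    by (simp add: exp_add mult.commute)
  also have "\<dots> \<le> exp (l\<^sup>2 * (d k)\<^sup>2 / 8) *
      exp (l * measure_pmf.expectation (Pi_pmf S z p) ?h + l\<^sup>2 * (\<Sum>k\<in>S. (d k)\<^sup>2) / 8)"
    by (intro mult_left_mono insert.IH h) auto
  also have "\<dots> = exp (l * measure_pmf.expectation (Pi_pmf (insert k S) z p) f
      + l\<^sup>2 * (\<Sum>k\<in>insert k S. (d k)\<^sup>2) / 8)"
    using insert.hyps by (simp add: expectation_Pi_pmf_insert exp_add[symmetric] field_simps)
  finally show ?case .
qed

theorem McDiarmid_ineq_ge: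
  fixes f :: "('k::finite \<Rightarrow> 'a::finite) \<Rightarrow> real"
  assumes d: "\<And>g k x y. \<bar>f (g(k := x)) - f (g(k := y))\<bar> \<le> d k"
    and "0 < \<epsilon>" and pos: "0 < (\<Sum>k\<in>S. (d k)\<^sup>2)"
  shows "measure_pmf.prob (Pi_pmf S z p) {g. measure_pmf.expectation (Pi_pmf S z p) f + \<epsilon> \<le> f g}
    \<le> exp (- 2 * \<epsilon>\<^sup>2 / (\<Sum>k\<in>S. (d k)\<^sup>2))"
proof -
  let ?P = "Pi_pmf S z p" and ?D = "\<Sum>k\<in>S. (d k)\<^sup>2"
  let ?E = "measure_pmf.expectation ?P f"
  \<comment> \<open>Chernoff's method; this \<open>l\<close> minimizes the exponent
    \<open>l\<^sup>2 * ?D / 8 - l * \<epsilon>\<close>.\<close>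
  define l where "l = 4 * \<epsilon> / ?D"
  have "0 < l"
    using assms by (simp add: l_def)
  have "measure_pmf.prob ?P {g. ?E + \<epsilon> \<le> f g} = measure_pmf.prob ?P {g \<in> space ?P. exp (l * (?E + \<epsilon>)) \<le> exp (l * f g)}"
    using \<open>0 < l\<close> by simp
  also have "\<dots> \<le> measure_pmf.expectation ?P (\<lambda>g. exp (l * f g)) / exp (l * (?E + \<epsilon>))"
    by (intro integral_Markov_inequality_measure[where A = "{}"]) auto
  also have "\<dots> \<le> exp (l * ?E + l\<^sup>2 * ?D / 8) / exp (l * (?E + \<epsilon>))"
    by (intro divide_right_mono McDiarmid_exp_moment d \<open>0 < l\<close>) auto
  also have "\<dots> = exp (l\<^sup>2 * ?D / 8 - l * \<epsilon>)"
    by (simp add: exp_diff[symmetric] algebra_simps)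
  also have "l\<^sup>2 * ?D / 8 - l * \<epsilon> = - 2 * \<epsilon>\<^sup>2 / ?D"
    using pos by (simp add: l_def field_simps power2_eq_square)
  finally show ?thesis .
qed

section \<open>Second moments of sums of independent centred vectors\<close>

lemma expectation_norm_sum_sq:
  fixes X :: "'a::finite \<Rightarrow> 'v::euclidean_space"
  assumes mean: "\<And>u. measure_pmf.expectation q (\<lambda>y. X y \<bullet> u) = 0"
  shows "measure_pmf.expectation (Pi_pmf S z (\<lambda>_. q)) (\<lambda>g. (norm (v + (\<Sum>k\<in>S. X (g (k::'k::finite)))))\<^sup>2)
    = real (card S) * measure_pmf.expectation q (\<lambda>y. (norm (X y))\<^sup>2) + (norm v)\<^sup>2"
  using finite[of S]
proof (induction S arbitrary: v rule: finite_induct)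
  case empty
  then show ?case
    by simp
next
  case (insert k S)
  let ?s = "measure_pmf.expectation q (\<lambda>y. (norm (X y))\<^sup>2)"
  have "(\<Sum>i\<in>S. X ((g(k := y)) i)) = (\<Sum>i\<in>S. X (g i))" for g y
    using insert.hyps by (intro sum.cong) auto
  then have "(norm (v + (\<Sum>i\<in>insert k S. X ((g(k := y)) i))))\<^sup>2
      = (norm (v + (\<Sum>i\<in>S. X (g i))))\<^sup>2 + (norm (X y))\<^sup>2 + 2 * (X y \<bullet> (v + (\<Sum>i\<in>S. X (g i))))" for g y
    using insert.hyps by (simp add: power2_norm_eq_inner inner_add_left inner_add_right inner_commute algebra_simps)
  \<comment> \<open>For fixed \<open>g\<close> the cross term is \<open>X y\<close> against a
    constant vector, so averaging over \<open>y\<close> removes it by \<open>mean\<close>.\<close>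
  then have "measure_pmf.expectation (Pi_pmf (insert k S) z (\<lambda>_. q)) (\<lambda>g. (norm (v + (\<Sum>i\<in>insert k S. X (g i))))\<^sup>2)
      = measure_pmf.expectation (Pi_pmf S z (\<lambda>_. q)) (\<lambda>g. (norm (v + (\<Sum>i\<in>S. X (g i))))\<^sup>2 + ?s)"
    using insert.hyps by (simp add: expectation_Pi_pmf_insert mean)
  also have "\<dots> = real (card (insert k S)) * ?s + (norm v)\<^sup>2"
    using insert.hyps by (simp add: insert.IH algebra_simps)
  finally show ?case .
qed

text \<open>The squared mean is at most the second moment, since the variance is nonnegative; the
  second moment is additive over the independent summands.\<close>

lemma expectation_norm_sum_le:
  fixes X :: "'a::finite \<Rightarrow> 'v::euclidean_space"
  assumes mean: "\<And>u. measure_pmf.expectation q (\<lambda>y. X y \<bullet> u) = 0"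
    and second: "measure_pmf.expectation q (\<lambda>y. (norm (X y))\<^sup>2) \<le> s\<^sup>2" and "0 \<le> s"
  shows "measure_pmf.expectation (Pi_pmf S z (\<lambda>_. q)) (\<lambda>g. norm (\<Sum>k\<in>S. X (g (k::'k::finite))))
    \<le> s * sqrt (card S)"
proof (rule power2_le_imp_le)
  let ?P = "Pi_pmf S z (\<lambda>_. q)"
  let ?N = "\<lambda>g. norm (\<Sum>k\<in>S. X (g (k::'k)))"
  have "measure_pmf.variance ?P ?N = measure_pmf.expectation ?P (\<lambda>g. (?N g)\<^sup>2) - (measure_pmf.expectation ?P ?N)\<^sup>2"
    by (rule measure_pmf.variance_eq) auto
  then have "(measure_pmf.expectation ?P ?N)\<^sup>2 \<le> measure_pmf.expectation ?P (\<lambda>g. (?N g)\<^sup>2)"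
    using measure_pmf.variance_positive[of ?P ?N] by linarith
  also have "\<dots> = real (card S) * measure_pmf.expectation q (\<lambda>y. (norm (X y))\<^sup>2)"
    using expectation_norm_sum_sq[OF mean, of S z 0] by simp
  also have "\<dots> \<le> real (card S) * s\<^sup>2"
    by (intro mult_left_mono second) auto
  finally show "(measure_pmf.expectation ?P ?N)\<^sup>2 \<le> (s * sqrt (card S))\<^sup>2"
    by (simp add: power_mult_distrib mult.commute)
  show "0 \<le> s * sqrt (card S)"
    using \<open>0 \<le> s\<close> by simp
qed

section \<open>From independent random variables to the product distribution\<close>

lemma (in prob_space) prob_iid_eq_Pi_pmf:
  fixes j :: "'k::finite \<Rightarrow> 'a \<Rightarrow> 'n::finite"
  assumes indep: "indep_vars (\<lambda>_. count_space UNIV) j UNIV"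
    and law: "\<And>k t. prob {\<omega> \<in> space M. j k \<omega> = t} = pmf (q k) t"
  shows "prob {\<omega> \<in> space M. (\<lambda>k. j k \<omega>) \<in> G} = measure_pmf.prob (Pi_pmf UNIV z q) G"
proof -
  have rv: "j k \<in> measurable M (count_space UNIV)" for k
    using indep by (auto simp: indep_vars_def)
  let ?ev = "\<lambda>g. {\<omega> \<in> space M. (\<lambda>k. j k \<omega>) = g}"
  have ev_eq: "?ev g = (\<Inter>k\<in>UNIV. j k -` {g k} \<inter> space M)" for g
    by auto
  have meas: "?ev g \<in> events" for g
    unfolding ev_eq using rv by (intro sets.finite_INT) (auto intro: measurable_sets)
  have pt: "prob (?ev g) = pmf (Pi_pmf UNIV z q) g" for g
  proof -
    have "prob (?ev g) = (\<Prod>k\<in>UNIV. prob (j k -` {g k} \<inter> space M))"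
      unfolding ev_eq by (intro indep_varsD_finite[OF indep]) auto
    also have "\<dots> = (\<Prod>k\<in>UNIV. pmf (q k) (g k))"
      by (simp add: law[symmetric] vimage_def Int_def conj_commute)
    finally show ?thesis
      by (simp add: pmf_Pi)
  qed
  \<comment> \<open>There are finitely many index maps, so agreement on single outcomes extends to
    \<open>G\<close> by summation.\<close>
  have "{\<omega> \<in> space M. (\<lambda>k. j k \<omega>) \<in> G} = (\<Union>g\<in>G. ?ev g)"
    by auto
  also have "prob \<dots> = (\<Sum>g\<in>G. prob (?ev g))"
    by (intro finite_measure_finite_Union) (use meas in \<open>auto simp: disjoint_family_on_def\<close>)
  also have "\<dots> = measure_pmf.prob (Pi_pmf UNIV z q) G"
    by (simp add: pt measure_measure_pmf_finite)
  finally show ?thesis .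
qed

subsection \<open>Column sampling\<close>

text \<open>The point \<open>y\<close> may violate the equations: the dual argument charges its
  distance to \<open>x\<close> at rate \<open>chi\<close>. Its support in \<open>range J\<close> is
  where the reduced costs are known to be nonnegative.\<close>

lemma sampled_value_le:
  fixes A :: "real^'n^'m" and b :: "real^'m" and c x y :: "real^'n" and J :: "'k::finite \<Rightarrow> 'n"
  assumes ne: "std_feasible (sel_cols A J) b \<noteq> {}" and rank: "rank (sel_cols A J) = CARD('m)"
    and chi_bound: "\<And>B x. is_basic_solution A b B x \<Longrightarrow> norm (reduced_cost A c B) \<le> chi"
    and x: "A *v x = b" and y: "0 \<le> y" "\<And>t. t \<notin> range J \<Longrightarrow> y $ t = 0"
  shows "opt_value (sel_vec c J) (std_feasible (sel_cols A J) b) \<le> ereal (c \<bullet> x + chi * norm (y - x))"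
proof (rule dense_le)
  fix r assume r: "r < opt_value (sel_vec c J) (std_feasible (sel_cols A J) b)"
  show "r \<le> ereal (c \<bullet> x + chi * norm (y - x))"
  proof (cases r)
    case (real r')
    obtain B p where B: "is_basis A B" and rc: "reduced_cost A c B = c - p v* A"
      and nonneg: "\<And>t. t \<in> range J \<Longrightarrow> 0 \<le> reduced_cost A c B $ t" and r': "r' < p \<bullet> b"
      using sampled_value_above[OF ne rank r[unfolded real]] by blast
    define d where "d = reduced_cost A c B"
    have "0 \<le> d $ t * y $ t" for t
      using y nonneg[of t] by (cases "t \<in> range J") (auto simp: d_def less_eq_vec_def)
    then have "0 \<le> d \<bullet> y"
      by (simp add: inner_vec_def sum_nonneg)
    have "p \<bullet> b = (c - d) \<bullet> x"
      by (simp add: d_def rc dot_lmul_matrix flip: x)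
    also have "\<dots> = c \<bullet> x + d \<bullet> (y - x) - d \<bullet> y"
      by (simp add: inner_diff_left inner_diff_right)
    also have "\<dots> \<le> c \<bullet> x + norm d * norm (y - x)"
      using \<open>0 \<le> d \<bullet> y\<close> norm_cauchy_schwarz[of d "y - x"] by linarith
    also have "norm d \<le> chi"
      using ex_basic_solution[OF B, of b] chi_bound by (auto simp: d_def)
    then have "norm d * norm (y - x) \<le> chi * norm (y - x)"
      by (intro mult_right_mono) auto
    finally show ?thesis
      using r' real by simp
  qed (use r in auto)
qed

text \<open>Weighting a draw \<open>t\<close> by \<open>x $ t / pmf q t\<close> makes the estimate
  unbiased, and the box constraint bounds each weight by \<open>C\<close>. This controls both the
  mean error and the effect of changing one draw.\<close>

lemma importance_sampling_norm_error:
  fixes x :: "real^'n" and q :: "'n pmf"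
  defines "est \<equiv> \<lambda>g :: 'k::finite \<Rightarrow> 'n.
    (1 / real CARD('k)) *\<^sub>R (\<Sum>k\<in>UNIV. (x $ g k / pmf q (g k)) *\<^sub>R axis (g k) 1)"
  assumes x: "\<And>t. 0 \<le> x $ t" "\<And>t. x $ t \<le> C * pmf q t"
    and "0 < C" and delta: "0 < \<delta>" "\<delta> < 1"
  shows "1 - \<delta> \<le> measure_pmf.prob (Pi_pmf UNIV z (\<lambda>_. q))
    {g. norm (est g - x) \<le> C / sqrt (real CARD('k)) * (1 + sqrt (2 * ln (1 / \<delta>)))}"
proof -
  let ?K = "real CARD('k)" and ?P = "Pi_pmf (UNIV :: 'k set) z (\<lambda>_. q)"
  define w where "w t = x $ t / pmf q t" for t
  define X where "X t = (1 / ?K) *\<^sub>R (w t *\<^sub>R axis t 1 - x)" for t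
  define f where "f g = norm (\<Sum>k\<in>UNIV. X (g k))" for g :: "'k \<Rightarrow> 'n"
  \<comment> \<open>Changing one draw costs at most \<open>2 * C / ?K\<close>, so the squared
    differences sum to \<open>4 * C\<^sup>2 / ?K\<close>; this \<open>\<epsilon>\<close> makes the
    McDiarmid exponent equal to \<open>- ln (1 / \<delta>)\<close>.\<close>
  define \<epsilon> where "\<epsilon> = C / sqrt ?K * sqrt (2 * ln (1 / \<delta>))"
  have K: "0 < ?K"
    by simp
  have f_eq: "norm (est g - x) = f g" for g
  proof -
    have "(\<Sum>k\<in>UNIV. X (g k)) = (1 / ?K) *\<^sub>R (\<Sum>k\<in>UNIV. w (g k) *\<^sub>R axis (g k) 1 - x)"
      by (simp only: X_def scaleR_sum_right)
    also have "\<dots> = (1 / ?K) *\<^sub>R ((\<Sum>k\<in>UNIV. w (g k) *\<^sub>R axis (g k) 1) - ?K *\<^sub>R x)"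
      by (simp only: sum_subtractf sum_constant_scaleR)
    also have "\<dots> = est g - x"
      by (simp add: est_def w_def scaleR_right_diff_distrib)
    finally show ?thesis
      by (simp add: f_def)
  qed
  \<comment> \<open>Where \<open>pmf q t = 0\<close>, the box constraint forces
    \<open>x $ t = 0\<close>, which agrees with the default value of division by zero.\<close>
  have w: "0 \<le> w t" "w t \<le> C" "w t * pmf q t = x $ t" for t
  proof -
    show "0 \<le> w t"
      using x(1) by (simp add: w_def)
    show "w t * pmf q t = x $ t"
      using x(1)[of t] x(2)[of t] by (cases "pmf q t = 0") (auto simp: w_def)
    show "w t \<le> C"
      using x(2)[of t] \<open>0 < C\<close> by (cases "pmf q t = 0") (auto simp: w_def divide_le_eq less_le)
  qed
  have E: "measure_pmf.expectation q h = (\<Sum>t\<in>UNIV. h t * pmf q t)" for h :: "'n \<Rightarrow> real"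
    by (rule integral_measure_pmf_real) auto
  have sum1: "(\<Sum>t\<in>UNIV. pmf q t) = 1"
    by (rule sum_pmf_eq_1) auto
  have mean: "measure_pmf.expectation q (\<lambda>t. X t \<bullet> u) = 0" for u
  proof -
    have "measure_pmf.expectation q (\<lambda>t. X t \<bullet> u) = (1 / ?K) * (\<Sum>t\<in>UNIV. (w t * u $ t - x \<bullet> u) * pmf q t)"
      unfolding E sum_distrib_left
      by (simp add: X_def inner_diff_left inner_axis' mult.assoc)
    also have "(\<Sum>t\<in>UNIV. (w t * u $ t - x \<bullet> u) * pmf q t)
        = (\<Sum>t\<in>UNIV. (w t * pmf q t) * u $ t) - (x \<bullet> u) * (\<Sum>t\<in>UNIV. pmf q t)"
      by (simp add: sum_distrib_left sum_subtractf[symmetric] algebra_simps)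
    also have "\<dots> = 0"
      by (simp add: w sum1 inner_vec_def)
    finally show ?thesis
      by simp
  qed
  have second: "measure_pmf.expectation q (\<lambda>t. (norm (X t))\<^sup>2) \<le> (C / ?K)\<^sup>2"
  proof -
    have sq: "(norm (X t))\<^sup>2 = (1 / ?K)\<^sup>2 * ((w t)\<^sup>2 - 2 * w t * x $ t + x \<bullet> x)" for t
    proof -
      have "(norm (X t))\<^sup>2 = (1 / ?K)\<^sup>2 * (norm (w t *\<^sub>R axis t 1 - x))\<^sup>2"
        by (simp only: X_def norm_scaleR power_mult_distrib power2_abs)
      also have "(norm (w t *\<^sub>R axis t 1 - x))\<^sup>2 = (w t)\<^sup>2 - 2 * w t * x $ t + x \<bullet> x"
        unfolding power2_norm_eq_inner
        by (simp add: inner_diff_left inner_diff_right inner_axis inner_axis' power2_eq_square algebra_simps)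
      finally show ?thesis .
    qed
    have "measure_pmf.expectation q (\<lambda>t. (norm (X t))\<^sup>2)
        = (1 / ?K)\<^sup>2 * (\<Sum>t\<in>UNIV. ((w t)\<^sup>2 - 2 * w t * x $ t + x \<bullet> x) * pmf q t)"
      unfolding E sq by (simp add: sum_distrib_left mult.assoc)
    also have "(\<Sum>t\<in>UNIV. ((w t)\<^sup>2 - 2 * w t * x $ t + x \<bullet> x) * pmf q t)
        = (\<Sum>t\<in>UNIV. (w t)\<^sup>2 * pmf q t) - 2 * (\<Sum>t\<in>UNIV. (w t * pmf q t) * x $ t)
          + (x \<bullet> x) * (\<Sum>t\<in>UNIV. pmf q t)"
      by (simp add: sum_distrib_left sum_subtractf[symmetric] sum.distrib[symmetric] algebra_simps)
    \<comment> \<open>Variance identity: centring subtracts the squared norm of the mean, leaving at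
      most the second moment of the weights.\<close>
    also have "\<dots> = (\<Sum>t\<in>UNIV. (w t)\<^sup>2 * pmf q t) - x \<bullet> x"
      by (simp add: w sum1 inner_vec_def)
    also have "\<dots> \<le> (\<Sum>t\<in>UNIV. C\<^sup>2 * pmf q t)"
    proof -
      have "(\<Sum>t\<in>UNIV. (w t)\<^sup>2 * pmf q t) \<le> (\<Sum>t\<in>UNIV. C\<^sup>2 * pmf q t)"
        by (intro sum_mono mult_right_mono power_mono w) auto
      then show ?thesis
        using inner_ge_zero[of x] by linarith
    qed
    also have "\<dots> = C\<^sup>2"
      by (simp add: sum_distrib_left[symmetric] sum1)
    finally show ?thesis
      by (simp add: power_divide mult_left_mono divide_right_mono)
  qed
  have mean_f: "measure_pmf.expectation ?P f \<le> C / sqrt ?K"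
  proof -
    have "measure_pmf.expectation ?P f \<le> C / ?K * sqrt ?K"
      unfolding f_def using expectation_norm_sum_le[OF mean second, of UNIV z] \<open>0 < C\<close> by simp
    also have "\<dots> = C / sqrt ?K"
      by (simp add: real_div_sqrt field_simps)
    finally show ?thesis .
  qed
  have diff: "\<bar>f (g(k := s)) - f (g(k := t))\<bar> \<le> 2 * C / ?K" for g k s t
  proof -
    have split: "(\<Sum>i\<in>UNIV. X ((g(k := t)) i)) = X t + (\<Sum>i\<in>UNIV - {k}. X (g i))" for t
      by (subst sum.remove[of _ k]) (auto intro!: sum.cong)
    have "\<bar>f (g(k := s)) - f (g(k := t))\<bar> \<le> norm (X s - X t)"
      unfolding f_def split using norm_triangle_ineq3[of "X s + (\<Sum>i\<in>UNIV - {k}. X (g i))" "X t + (\<Sum>i\<in>UNIV - {k}. X (g i))"]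
      by (simp only: add_diff_cancel_right)
    \<comment> \<open>The centring terms cancel, leaving two multiples of unit vectors, each of norm
      at most \<open>C\<close>.\<close>
    also have "X s - X t = (1 / ?K) *\<^sub>R (w s *\<^sub>R axis s 1 - w t *\<^sub>R axis t 1)"
      by (simp add: X_def algebra_simps)
    also have "norm \<dots> = norm (w s *\<^sub>R axis s 1 - w t *\<^sub>R (axis t 1 :: real^'n)) / ?K"
      by simp
    also have "\<dots> \<le> (w s + w t) / ?K"
      using norm_triangle_ineq4[of "w s *\<^sub>R axis s 1" "w t *\<^sub>R (axis t 1 :: real^'n)"] w(1)
      by (intro divide_right_mono) auto
    also have "\<dots> \<le> 2 * C / ?K"
      using w(2)[of s] w(2)[of t] by (intro divide_right_mono) auto
    finally show ?thesis .
  qed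
  have ln_pos: "0 < ln (1 / \<delta>)"
    using delta by simp
  have D: "(\<Sum>k\<in>(UNIV :: 'k set). (2 * C / ?K)\<^sup>2) = 4 * C\<^sup>2 / ?K"
    by (simp add: power2_eq_square field_simps)
  have "measure_pmf.prob ?P {g. measure_pmf.expectation ?P f + \<epsilon> \<le> f g}
      \<le> exp (- 2 * \<epsilon>\<^sup>2 / (4 * C\<^sup>2 / ?K))"
    using McDiarmid_ineq_ge[of f "\<lambda>_. 2 * C / ?K" \<epsilon> UNIV z "\<lambda>_. q"] diff \<open>0 < C\<close> ln_pos
    unfolding D by (simp add: \<epsilon>_def)
  also have "- 2 * \<epsilon>\<^sup>2 / (4 * C\<^sup>2 / ?K) = - ln (1 / \<delta>)"
    using \<open>0 < C\<close> ln_pos by (simp add: \<epsilon>_def power_mult_distrib power_divide field_simps)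
  also have "exp (- ln (1 / \<delta>)) = \<delta>"
    using delta by (simp add: ln_div)
  finally have "1 - \<delta> \<le> 1 - measure_pmf.prob ?P {g. measure_pmf.expectation ?P f + \<epsilon> \<le> f g}"
    by simp
  also have "\<dots> = measure_pmf.prob ?P (- {g. measure_pmf.expectation ?P f + \<epsilon> \<le> f g})"
    using measure_pmf.prob_compl[of "{g. measure_pmf.expectation ?P f + \<epsilon> \<le> f g}" ?P]
    by (simp add: Compl_eq_Diff_UNIV)
  also have "\<dots> \<le> measure_pmf.prob ?P
      {g. norm (est g - x) \<le> C / sqrt ?K * (1 + sqrt (2 * ln (1 / \<delta>)))}"
    using mean_f by (intro measure_pmf.finite_measure_mono) (auto simp: f_eq \<epsilon>_def distrib_left)
  finally show ?thesis .
qed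

section \<open>Attained and finite optimal values\<close>

lemma opt_value_distr_attained:
  assumes "distr_feasible A b C \<xi> \<noteq> {}"
  shows "\<exists>x\<in>distr_feasible A b C \<xi>. opt_value c (distr_feasible A b C \<xi>) = ereal (c \<bullet> x)"
proof -
  \<comment> \<open>The upper bounds turn the feasible set into a closed slice of a box, so
    compactness gives a minimizer.\<close>
  have "distr_feasible A b C \<xi> = cbox 0 (C *\<^sub>R \<xi>) \<inter> {x. A *v x = b}"
    by (auto simp: distr_feasible_def simp flip: interval_cbox_cart)
  moreover have "closed {x. A *v x = b}"
    by (intro closed_Collect_eq continuous_intros)
  ultimately have compact: "compact (distr_feasible A b C \<xi>)"
    by (simp add: compact_Int_closed)
  have cont: "continuous_on (distr_feasible A b C \<xi>) (\<lambda>x. c \<bullet> x)"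
    by (intro continuous_intros)
  obtain x where x: "x \<in> distr_feasible A b C \<xi>"
      "\<And>y. y \<in> distr_feasible A b C \<xi> \<Longrightarrow> c \<bullet> x \<le> c \<bullet> y"
    using continuous_attains_inf[OF compact assms cont] by blast
  have "opt_value c (distr_feasible A b C \<xi>) = ereal (c \<bullet> x)"
    unfolding opt_value_def by (intro antisym INF_lower INF_greatest x) (simp add: x)
  with x(1) show ?thesis
    by blast
qed

lemma opt_value_finite:
  assumes "S \<noteq> {}" "bdd_below ((\<lambda>x. c \<bullet> x) ` S)"
  shows "\<exists>v. opt_value c S = ereal v"
proof -
  obtain x where "x \<in> S"
    using assms by blast
  obtain L where "\<And>y. y \<in> S \<Longrightarrow> L \<le> c \<bullet> y"
    using assms(2) by (auto simp: bdd_below_def)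
  then have "ereal L \<le> opt_value c S"
    unfolding opt_value_def by (intro INF_greatest) auto
  moreover have "opt_value c S \<le> ereal (c \<bullet> x)"
    unfolding opt_value_def by (intro INF_lower \<open>x \<in> S\<close>)
  ultimately show ?thesis
    by (cases "opt_value c S") auto
qed

theorem theorem2:
  fixes A :: "real^'n^'m" and b :: "real^'m" and c \<xi> :: "real^'n"
    and C chi \<delta> :: real
    and M :: "'w measure" and j :: "'k::finite \<Rightarrow> 'w \<Rightarrow> 'n"
  assumes feas: "std_feasible A b \<noteq> {}"
    and bounded: "bdd_below ((\<lambda>x. c \<bullet> x) ` std_feasible A b)"
    and rank: "rank A = CARD('m)"
    and norm_c: "norm c = 1"
    and xi_nonneg: "\<And>t. 0 \<le> \<xi> $ t"
    and xi_sum: "(\<Sum>t\<in>UNIV. \<xi> $ t) = 1"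
    and M: "prob_space M"
    and indep: "prob_space.indep_vars M (\<lambda>_. count_space UNIV) j UNIV"
    and distr_j: "\<And>k t. measure M {\<omega> \<in> space M. j k \<omega> = t} = \<xi> $ t"
    and C: "C > 0"
    and chi_bound: "\<And>B x. is_basic_solution A b B x \<Longrightarrow> norm (reduced_cost A c B) \<le> chi"
    and delta: "0 < \<delta>" "\<delta> < 1"
  shows "measure M {\<omega> \<in> space M.
           let J = (\<lambda>k. j k \<omega>); A\<^sub>J = sel_cols A J; c\<^sub>J = sel_vec c J in
             std_feasible A\<^sub>J b \<noteq> {} \<and> rank A\<^sub>J = CARD('m) \<longrightarrow>
             value_gap A b c (opt_value c\<^sub>J (std_feasible A\<^sub>J b))
               \<le> value_gap A b c (opt_value c (distr_feasible A b C \<xi>))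
                 + ereal (C / sqrt (real CARD('k)) * chi * (1 + sqrt (2 * ln (1 / \<delta>))))}
         \<ge> 1 - \<delta>"
proof -
  interpret prob_space M by (fact M)
  let ?rhs = "C / sqrt (real CARD('k)) * chi * (1 + sqrt (2 * ln (1 / \<delta>)))"
  define q where "q = embed_pmf (\<lambda>t. \<xi> $ t)"
  have q: "pmf q t = \<xi> $ t" for t
    unfolding q_def using xi_nonneg xi_sum
    by (intro pmf_embed_pmf) (auto simp: nn_integral_count_space_finite)
  \<comment> \<open>Full rank provides at least one basis, and the norm of its reduced cost vector
    is a lower bound for \<open>chi\<close>. The sign is used when the error bound is multiplied by
    \<open>chi\<close>.\<close>
  have chi_nonneg: "0 \<le> chi"
  proof -
    have "dim (columns A) = CARD('m)"
      using rank by (simp add: column_rank_def)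
    then have "span (columns A) = UNIV"
      by (simp add: dim_eq_full[symmetric])
    then have "span {column t A | t. t \<in> UNIV} = UNIV"
      by (simp add: columns_def)
    from ex_basis_subset[OF this] obtain B where "is_basis A B"
      by blast
    then show ?thesis
      using ex_basic_solution[of A B b] chi_bound by (meson norm_ge_zero order_trans)
  qed
  obtain v where v: "opt_value c (std_feasible A b) = ereal v"
    using opt_value_finite[OF feas bounded] by blast
  define G where "G = {J :: 'k \<Rightarrow> 'n. std_feasible (sel_cols A J) b \<noteq> {} \<and> rank (sel_cols A J) = CARD('m) \<longrightarrow>
      value_gap A b c (opt_value (sel_vec c J) (std_feasible (sel_cols A J) b))
        \<le> value_gap A b c (opt_value c (distr_feasible A b C \<xi>)) + ereal ?rhs}"
  have "1 - \<delta> \<le> measure_pmf.prob (Pi_pmf UNIV z (\<lambda>_. q)) G" for z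
  proof (cases "distr_feasible A b C \<xi> = {}")
    \<comment> \<open>An infeasible distributional problem has value infinity; as \<open>v\<close>
      is finite, its gap is infinity as well and every sample satisfies the bound.\<close>
    case True
    then have "G = UNIV"
      by (simp add: G_def opt_value_def value_gap_def v top_ereal_def)
    with delta show ?thesis
      by simp
  next
    case False
    then obtain x where x: "x \<in> distr_feasible A b C \<xi>"
        and opt: "opt_value c (distr_feasible A b C \<xi>) = ereal (c \<bullet> x)"
      using opt_value_distr_attained by blast
    let ?est = "\<lambda>J :: 'k \<Rightarrow> 'n.
      (1 / real CARD('k)) *\<^sub>R (\<Sum>k\<in>UNIV. (x $ J k / pmf q (J k)) *\<^sub>R axis (J k) 1) :: real^'n"
    let ?err = "C / sqrt (real CARD('k)) * (1 + sqrt (2 * ln (1 / \<delta>)))"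
    have x_nonneg: "0 \<le> x $ t" and x_le: "x $ t \<le> C * pmf q t" for t
      using x by (auto simp: distr_feasible_def less_eq_vec_def q)
    have "J \<in> G" if err: "norm (?est J - x) \<le> ?err" for J
    proof -
      have "value_gap A b c (opt_value (sel_vec c J) (std_feasible (sel_cols A J) b))
          \<le> value_gap A b c (opt_value c (distr_feasible A b C \<xi>)) + ereal ?rhs"
        if ne: "std_feasible (sel_cols A J) b \<noteq> {}" and rk: "rank (sel_cols A J) = CARD('m)"
      proof -
        have est_nonneg: "0 \<le> ?est J"
          using x_nonneg by (auto simp: less_eq_vec_def axis_def intro!: sum_nonneg divide_nonneg_nonneg)
        have est_supp: "?est J $ t = 0" if "t \<notin> range J" for t
          using that by (auto simp: axis_def intro!: sum.neutral)
        have "A *v x = b"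
          using x by (simp add: distr_feasible_def)
        from sampled_value_le[OF ne rk chi_bound this est_nonneg est_supp]
        have le: "opt_value (sel_vec c J) (std_feasible (sel_cols A J) b)
            \<le> ereal (c \<bullet> x + chi * norm (?est J - x))" .
        have "0 \<le> chi"
          by (rule chi_nonneg)
        then have "chi * norm (?est J - x) \<le> ?rhs"
          using mult_left_mono[OF err, of chi] by (simp add: mult_ac)
        with le have "opt_value (sel_vec c J) (std_feasible (sel_cols A J) b) \<le> ereal (c \<bullet> x + ?rhs)"
          by (meson add_left_mono ereal_less_eq(3) order_trans)
        \<comment> \<open>Subtracting the finite \<open>v\<close> from both values turns the bound
          on values into one on gaps.\<close>
        then show ?thesis
          by (cases "opt_value (sel_vec c J) (std_feasible (sel_cols A J) b)")
             (auto simp: value_gap_def v opt)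
      qed
      then show ?thesis
        by (simp add: G_def)
    qed
    then have "measure_pmf.prob (Pi_pmf UNIV z (\<lambda>_. q)) {J. norm (?est J - x) \<le> ?err}
        \<le> measure_pmf.prob (Pi_pmf UNIV z (\<lambda>_. q)) G"
      by (intro measure_pmf.finite_measure_mono) auto
    with importance_sampling_norm_error[OF x_nonneg x_le C delta, where z = z and 'k = 'k]
    show ?thesis
      by linarith
  qed
  also have "measure_pmf.prob (Pi_pmf UNIV undefined (\<lambda>_. q)) G = prob {\<omega> \<in> space M. (\<lambda>k. j k \<omega>) \<in> G}"
    by (rule prob_iid_eq_Pi_pmf[symmetric, OF indep]) (simp add: distr_j q)
  finally show ?thesis
    by (simp add: G_def Let_def)
qed

end
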